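(* Let $\mathsf{K}^c_n$ be a complete convex graph of order $n$, with edge adjacency defined by the edge-crossing criterion. Then its pseudo-Grundy index satisfies $$\frac{n^2-16}{12}\le \gamma'(\mathsf{K}^c_n).$$
   Context: A geometric graph is a drawing of a graph in the plane in which the vertices are points in general position (no three collinear) and every edge is the straight-line segment joining its endpoints. A complete convex graph $\mathsf{K}^c_n$ of order $n$ is a geometric graph of the complete graph $K_n$ whose $n$ vertices are in convex position. Edge-crossing criterion: two distinct edges are adjacent if and only if they cross, i.e. they meet at a point interior to both segments. A pseudo-Grundy $k$-coloring is an assignment of the colors $1,\dots,k$ to all the edges (not necessarily proper), with every color used, such that for every pair of colors $i<j$, every edge of color $j$ is adjacent to at least one edge of color $i$. The pseudo-Grundy index $\gamma'(\mathsf{G})$ of a geometric graph $\mathsf{G}$ is the largest $k$ for which $\mathsf{G}$ has a pseudo-Grundy $k$-coloring. *)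

theory Defs
  imports "HOL-Analysis.Analysis"
begin

type_synonym point = "real ^ 2"

definition general_position :: "point set \<Rightarrow> bool" where
  "general_position S \<longleftrightarrow>
     (\<forall>a\<in>S. \<forall>b\<in>S. \<forall>c\<in>S. a \<noteq> b \<and> b \<noteq> c \<and> a \<noteq> c \<longrightarrow> \<not> collinear {a, b, c})"

text \<open>The edge \<open>{a, b}\<close> is drawn as the segment joining \<open>a\<close> and \<open>b\<close>.\<close>

definition geometric_graph :: "point set \<Rightarrow> point set set \<Rightarrow> bool" where
  "geometric_graph V E \<longleftrightarrow>
     finite V \<and> general_position V \<and> (\<forall>e\<in>E. e \<subseteq> V \<and> card e = 2)"

definition convex_position :: "point set \<Rightarrow> bool" where
  "convex_position S \<longleftrightarrow> (\<forall>x\<in>S. x \<notin> convex hull (S - {x}))"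

definition complete_convex_graph :: "nat \<Rightarrow> point set \<Rightarrow> point set set \<Rightarrow> bool" where
  "complete_convex_graph n V E \<longleftrightarrow>
     geometric_graph V E \<and> card V = n \<and> convex_position V \<and>
     E = {e. e \<subseteq> V \<and> card e = 2}"

definition crosses :: "point set \<Rightarrow> point set \<Rightarrow> bool" where
  "crosses e f \<longleftrightarrow> e \<noteq> f \<and>
     (\<exists>a b c d. e = {a, b} \<and> f = {c, d} \<and> open_segment a b \<inter> open_segment c d \<noteq> {})"

definition pseudo_Grundy_coloring ::
    "point set set \<Rightarrow> nat \<Rightarrow> (point set \<Rightarrow> nat) \<Rightarrow> bool" where
  "pseudo_Grundy_coloring E k col \<longleftrightarrow>
     col ` E = {1..k} \<and>
     (\<forall>i\<in>{1..k}. \<forall>j\<in>{1..k}. i < j \<longrightarrow>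
        (\<forall>e\<in>E. col e = j \<longrightarrow> (\<exists>f\<in>E. col f = i \<and> crosses e f)))"

text \<open>The index depends on the vertex set only through the edges.
  The maximum is over a finite nonempty set, as shown below, whenever \<open>E\<close> is finite.\<close>

definition pseudo_Grundy_index :: "point set set \<Rightarrow> nat" where
  "pseudo_Grundy_index E = Max {k. \<exists>col. pseudo_Grundy_coloring E k col}"

lemma pseudo_Grundy_coloring_le_card:
  assumes "finite E" "pseudo_Grundy_coloring E k col"
  shows "k \<le> card E"
proof -
  have "card (col ` E) \<le> card E"
    using assms(1) by (rule card_image_le)
  then show ?thesis
    using assms(2) by (simp add: pseudo_Grundy_coloring_def)
qed

lemma finite_pseudo_Grundy_numbers:
  assumes "finite E"
  shows "finite {k. \<exists>col. pseudo_Grundy_coloring E k col}"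
  by (rule finite_subset[of _ "{..card E}"])
     (use pseudo_Grundy_coloring_le_card[OF assms] in auto)

lemma pseudo_Grundy_coloring_exists: "\<exists>k col. pseudo_Grundy_coloring E k col"
proof (cases "E = {}")
  case True
  then have "pseudo_Grundy_coloring E 0 (\<lambda>_. 1)"
    by (simp add: pseudo_Grundy_coloring_def)
  then show ?thesis by blast
next
  case False
  then have "pseudo_Grundy_coloring E 1 (\<lambda>_. 1)"
    by (auto simp: pseudo_Grundy_coloring_def)
  then show ?thesis by blast
qed

lemma pseudo_Grundy_index_attained:
  assumes "finite E"
  shows "\<exists>col. pseudo_Grundy_coloring E (pseudo_Grundy_index E) col"
  using Max_in[OF finite_pseudo_Grundy_numbers[OF assms]] pseudo_Grundy_coloring_exists[of E]
  unfolding pseudo_Grundy_index_def by blast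

lemma pseudo_Grundy_index_ge:
  assumes "finite E" "pseudo_Grundy_coloring E k col"
  shows "k \<le> pseudo_Grundy_index E"
  unfolding pseudo_Grundy_index_def
  using finite_pseudo_Grundy_numbers[OF assms(1)] assms(2) by (intro Max_ge) auto

lemma finite_edges: "geometric_graph V E \<Longrightarrow> finite E"
  unfolding geometric_graph_def by (rule finite_subset[of _ "Pow V"]) auto

end

theory Submission
  imports Defs
begin

text \<open>The color classes are small sets of edges, and they are colored in the order of the lengths of
  their edges, where the length of an edge is the number of sides of the polygon on its shorter side.
  For this to work, a class of edges of length \<open>l\<close> has to block all edges of length at least \<open>l\<close>:
  each of them that lies in another class must cross an edge of the class. Any edges in no class
  can be given color 1 (\<open>card_blocking_family_le_index\<close>).

  Two crossing edges suffice to block whenever \<open>l\<close> is a little more than a third of the number of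
  vertices. They cut the disk into four regions, each with one arc of the polygon on its boundary,
  and an edge that crosses neither of them, and is neither of them, stays in one region. So
  it is enough that all four arcs are shorter than \<open>l\<close>. For two edges of length \<open>l\<close> in a polygon
  with \<open>n\<close> vertices such a position exists as soon as \<open>3 * l \<ge> n + 2\<close>, and for \<open>n = 2 * h\<close> the
  edges of length \<open>l\<close> can be partitioned into \<open>h\<close> such pairs (\<open>pair_class_blocks\<close>,
  \<open>pair_class_disjoint\<close>). The \<open>h\<close> diameters cross pairwise, so each of them is a class of its own.
  With roughly \<open>n / 6\<close> lengths and \<open>n / 2\<close> classes for each, this already gives the leading term
  \<open>n\<^sup>2 / 12\<close>.

  If the number of vertices is odd, one vertex is left out, so that \<open>n\<close> is even. To make up for this
  and for rounding, one more length is used when \<open>n\<close> is 0 or 2 modulo 6: for the least \<open>l\<close> with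
  \<open>3 * l \<ge> n\<close>, all but at most two edges of length \<open>l\<close> are grouped into paths of three edges
  (\<open>triple_class_blocks\<close>). The remaining slack is checked by counting in the last proof.

  The combinatorics rests on one geometric fact: points in convex position have a cyclic
  order such that edges with interleaved ends cross (\<open>cyclic_enumeration\<close>,
  \<open>interleaved_cross\<close>).\<close>

section \<open>Orientation of triples of points\<close>

text \<open>Twice the signed area of the triangle: positive for a counterclockwise turn.\<close>
definition orient :: "point \<Rightarrow> point \<Rightarrow> point \<Rightarrow> real" where
  "orient a b c = (b$1 - a$1) * (c$2 - a$2) - (b$2 - a$2) * (c$1 - a$1)"

lemma orient_rotate: "orient b c a = orient a b c"
  by (simp add: orient_def algebra_simps)

lemma orient_swap: "orient a c b = - orient a b c"
  by (simp add: orient_def algebra_simps)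

text \<open>The affine dependence of four points of the plane, with the signed areas of the four triangles as
  coefficients. All of the geometry below is read off from the signs in this identity: two
  positive coefficients on each side give crossing segments, and a one-to-three
  distribution puts a point into the convex hull of the others.\<close>
lemma orient_dependence:
  "orient b c d *\<^sub>R a + orient a b d *\<^sub>R c = orient a c d *\<^sub>R b + orient a b c *\<^sub>R d"
  "orient b c d + orient a b d = orient a c d + orient a b c"
  by (simp_all add: vec_eq_iff forall_2 orient_def algebra_simps)

lemma collinear_if_orient_eq_0:
  assumes "orient a b c = 0"
  shows "collinear {a, b, c}"
proof (cases "a = c")
  case False
  have "\<exists>t. b$1 - c$1 = t * (a$1 - c$1) \<and> b$2 - c$2 = t * (a$2 - c$2)"
  proof (cases "a$1 = c$1")
    case True
    then have ne: "a$2 - c$2 \<noteq> 0"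
      using False by (simp add: vec_eq_iff forall_2)
    have "(b$1 - a$1) * (a$2 - c$2) = 0"
      using assms True by (simp add: orient_def algebra_simps)
    then show ?thesis
      using ne True by (intro exI[of _ "(b$2 - c$2) / (a$2 - c$2)"]) simp
  next
    case ne: False
    have "(b$2 - c$2) * (a$1 - c$1) = (b$1 - c$1) * (a$2 - c$2)"
      using assms by (simp add: orient_def algebra_simps)
    then have "b$2 - c$2 = (b$1 - c$1) / (a$1 - c$1) * (a$2 - c$2)"
      using ne by (simp add: eq_divide_eq)
    then show ?thesis
      using ne by (intro exI[of _ "(b$1 - c$1) / (a$1 - c$1)"]) simp
  qed
  then obtain t where "b = t *\<^sub>R a + (1 - t) *\<^sub>R c"
    by (auto simp: vec_eq_iff forall_2 algebra_simps)
  then show ?thesis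
    by (auto simp: collinear_3_expand)
qed (simp add: insert_commute)

text \<open>Both sides of the dependence, divided by the common coefficient sum, are the crossing point.\<close>
lemma open_segments_meet:
  assumes "orient a b c > 0" "orient a b d > 0" "orient a c d > 0" "orient b c d > 0"
  shows "open_segment a c \<inter> open_segment b d \<noteq> {}"
proof -
  define s where "s = orient b c d + orient a b d"
  have s: "s > 0" "s = orient a c d + orient a b c"
    using assms orient_dependence(2)[of b c d a] by (simp_all add: s_def)
  define z where "z = (1 / s) *\<^sub>R (orient b c d *\<^sub>R a + orient a b d *\<^sub>R c)"
  have "a \<noteq> c" "b \<noteq> d"
    using assms by (auto simp: orient_def)
  moreover have "z = (1 - orient a b d / s) *\<^sub>R a + (orient a b d / s) *\<^sub>R c"
    "0 < orient a b d / s" "orient a b d / s < 1"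
    using s(1) assms by (simp_all add: z_def s_def scaleR_add_right divide_simps)
  moreover have "z = (1 - orient a b c / s) *\<^sub>R b + (orient a b c / s) *\<^sub>R d"
    using s(1) unfolding z_def orient_dependence(1)
    by (simp add: s(2) scaleR_add_right divide_simps)
  moreover have "0 < orient a b c / s" "orient a b c / s < 1"
    using s assms by (simp_all add: divide_simps)
  ultimately have "z \<in> open_segment a c" "z \<in> open_segment b d"
    unfolding in_segment by auto
  then show ?thesis by blast
qed

text \<open>The one-to-three distribution of signs, which convex position excludes.\<close>
lemma not_convex_position_if_combination:
  assumes "convex_position V" "{a, b, c, d} \<subseteq> V" "a \<notin> {b, c, d}"
    and "x > 0" "y > 0" "z > 0"
    and "(x + y + z) *\<^sub>R a = x *\<^sub>R b + y *\<^sub>R c + z *\<^sub>R d"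
  shows False
proof -
  define s where "s = x + y + z"
  have s: "s > 0" using assms by (simp add: s_def)
  have "a = (1 / s) *\<^sub>R (s *\<^sub>R a)"
    using s by simp
  also have "\<dots> = (x / s) *\<^sub>R b + (y / s) *\<^sub>R c + (z / s) *\<^sub>R d"
    unfolding s_def assms(7) by (simp add: scaleR_add_right divide_inverse_commute)
  finally have "a = (x / s) *\<^sub>R b + (y / s) *\<^sub>R c + (z / s) *\<^sub>R d" .
  moreover have "x / s + y / s + z / s = 1"
    using s by (simp add: s_def flip: add_divide_distrib)
  moreover have "0 \<le> x / s" "0 \<le> y / s" "0 \<le> z / s"
    using s assms by simp_all
  ultimately have "a \<in> convex hull {b, c, d}"
    unfolding convex_hull_3 by blast
  also have "\<dots> \<subseteq> convex hull (V - {a})"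
    using assms by (intro hull_mono) auto
  finally show False
    using assms by (auto simp: convex_position_def)
qed

lemma orient_ne_0:
  assumes "general_position V" "{a, b, c} \<subseteq> V" "a \<noteq> b" "b \<noteq> c" "a \<noteq> c"
  shows "orient a b c \<noteq> 0"
  using assms collinear_if_orient_eq_0[of a b c] unfolding general_position_def by auto

section \<open>The cyclic order of points in convex position\<close>

text \<open>The counterclockwise order around a point \<open>a\<close> need not be transitive in general: three points
  may wind once around \<open>a\<close>. But then \<open>a\<close> lies in their convex hull.\<close>
lemma orient_trans:
  assumes "general_position V" "convex_position V" "{a, b, c, d} \<subseteq> V"
    and "orient a b c > 0" "orient a c d > 0"
  shows "orient a b d > 0"
proof (rule ccontr)
  assume neg: "\<not> orient a b d > 0"
  have dist: "a \<noteq> b" "a \<noteq> c" "a \<noteq> d" "b \<noteq> c" "c \<noteq> d"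
    using assms by (auto simp: orient_def)
  have "b \<noteq> d"
    using assms orient_swap[of a b c] by auto
  then have "orient a b d < 0"
    using neg orient_ne_0[of V a b d] assms dist by auto
  moreover have "(orient a c d + - orient a b d + orient a b c) *\<^sub>R a
      = orient a c d *\<^sub>R b + (- orient a b d) *\<^sub>R c + orient a b c *\<^sub>R d"
  proof -
    have e: "orient a c d + - orient a b d + orient a b c = orient b c d"
      using orient_dependence(2)[of b c d a] by simp
    show ?thesis
      unfolding e using orient_dependence(1)[of b c d a] by (simp add: algebra_simps)
  qed
  ultimately show False
    using not_convex_position_if_combination[of V a b c d "orient a c d" "- orient a b d" "orient a b c"]
      assms dist by auto
qed

text \<open>If \<open>b\<close>, \<open>c\<close>, \<open>d\<close> follow each other around \<open>a\<close> but turn clockwise, then \<open>c\<close> lies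
  in the triangle \<open>a\<close>, \<open>b\<close>, \<open>d\<close>.\<close>
lemma orient_pos_if_sorted:
  assumes "general_position V" "convex_position V" "{a, b, c, d} \<subseteq> V"
    and "orient a b c > 0" "orient a c d > 0"
  shows "orient b c d > 0"
proof (rule ccontr)
  assume neg: "\<not> orient b c d > 0"
  have abd: "orient a b d > 0"
    using orient_trans assms by blast
  have dist: "a \<noteq> b" "a \<noteq> c" "a \<noteq> d" "b \<noteq> c" "c \<noteq> d" "b \<noteq> d"
    using assms abd by (auto simp: orient_def)
  then have "orient b c d < 0"
    using neg orient_ne_0[of V b c d] assms by auto
  moreover have "(orient a c d + orient a b c + - orient b c d) *\<^sub>R c
      = orient a c d *\<^sub>R b + orient a b c *\<^sub>R d + (- orient b c d) *\<^sub>R a"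
  proof -
    have e: "orient a c d + orient a b c + - orient b c d = orient a b d"
      using orient_dependence(2)[of b c d a] by simp
    show ?thesis
      unfolding e using orient_dependence(1)[of b c d a] by (simp add: algebra_simps)
  qed
  ultimately show False
    using not_convex_position_if_combination[of V c b d a "orient a c d" "orient a b c" "- orient b c d"]
      assms dist by auto
qed

text \<open>Number each element by how many elements precede it.\<close>
lemma finite_strict_order_enumeration:
  fixes R :: "'a \<Rightarrow> 'a \<Rightarrow> bool"
  assumes "finite V"
    and irrefl: "\<And>u. u \<in> V \<Longrightarrow> \<not> R u u"
    and trans: "\<And>u v w. u \<in> V \<Longrightarrow> v \<in> V \<Longrightarrow> w \<in> V \<Longrightarrow> R u v \<Longrightarrow> R v w \<Longrightarrow> R u w"
    and total: "\<And>u v. u \<in> V \<Longrightarrow> v \<in> V \<Longrightarrow> u \<noteq> v \<Longrightarrow> R u v \<or> R v u"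
  obtains p :: "nat \<Rightarrow> 'a" where "bij_betw p {..<card V} V"
    and "\<And>i j. i < j \<Longrightarrow> j < card V \<Longrightarrow> R (p i) (p j)"
proof -
  define rank where "rank v = card {u \<in> V. R u v}" for v
  have mono: "rank u < rank v" if "u \<in> V" "v \<in> V" "R u v" for u v
  proof -
    have "{x \<in> V. R x u} \<subseteq> {x \<in> V. R x v}"
      using trans[OF _ that(1,2) _ that(3)] by blast
    moreover have "u \<in> {x \<in> V. R x v} - {x \<in> V. R x u}"
      using that irrefl by blast
    ultimately show ?thesis
      unfolding rank_def using assms(1) by (intro psubset_card_mono) auto
  qed
  have "inj_on rank V"
    by (rule inj_onI) (use mono total in fastforce)
  moreover have "rank ` V \<subseteq> {..<card V}"
  proof safe
    fix v assume v: "v \<in> V"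
    then have "{u \<in> V. R u v} \<subset> V"
      using irrefl by blast
    then show "rank v < card V"
      unfolding rank_def using assms(1) by (rule psubset_card_mono[rotated])
  qed
  ultimately have bij: "bij_betw rank V {..<card V}"
    by (simp add: bij_betw_def card_image card_subset_eq)
  define p where "p = inv_into V rank"
  have p: "bij_betw p {..<card V} V"
    unfolding p_def using bij by (rule bij_betw_inv_into)
  have rank_p: "rank (p i) = i" if "i < card V" for i
    unfolding p_def using bij that by (simp add: bij_betw_inv_into_right)
  have p_in: "p i \<in> V" if "i < card V" for i
    using p that by (auto simp: bij_betw_def)
  show thesis
  proof
    show "R (p i) (p j)" if "i < j" "j < card V" for i j
    proof (rule ccontr)
      assume "\<not> R (p i) (p j)"
      then have "p i = p j \<or> R (p j) (p i)"
        using total[of "p i" "p j"] p_in that by auto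
      then have "rank (p j) \<le> rank (p i)"
        using mono[of "p j" "p i"] p_in that by auto
      then show False
        using rank_p that by simp
    qed
  qed (rule p)
qed

text \<open>Sort the points by angle around one of them, which comes first.\<close>
lemma cyclic_enumeration:
  assumes "finite V" "general_position V" "convex_position V"
  obtains p :: "nat \<Rightarrow> point" where "bij_betw p {..<card V} V"
    and "\<And>i j k. i < j \<Longrightarrow> j < k \<Longrightarrow> k < card V \<Longrightarrow> orient (p i) (p j) (p k) > 0"
proof (cases "V = {}")
  case True
  then show thesis
    using that[of "\<lambda>_. 0"] by (simp add: bij_betw_def)
next
  case False
  then obtain v0 where o: "v0 \<in> V" by blast
  define R where "R u v \<longleftrightarrow> v \<noteq> v0 \<and> (u = v0 \<or> orient v0 u v > 0)" for u v
  obtain p :: "nat \<Rightarrow> point" where p: "bij_betw p {..<card V} V"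
    and R: "\<And>i j. i < j \<Longrightarrow> j < card V \<Longrightarrow> R (p i) (p j)"
  proof (rule finite_strict_order_enumeration[of V R])
    show "\<not> R u u" for u
      by (auto simp: R_def orient_def)
    show "R u w" if "u \<in> V" "v \<in> V" "w \<in> V" "R u v" "R v w" for u v w
      using that orient_trans[of V v0 u v w] o assms unfolding R_def by auto
    show "R u v \<or> R v u" if "u \<in> V" "v \<in> V" "u \<noteq> v" for u v
      using that orient_ne_0[of V v0 u v] orient_swap[of v0 v u] o assms(2) unfolding R_def
      by (metis empty_subsetI insert_subset linorder_neqE_linordered_idom neg_0_less_iff_less)
  qed (use assms in auto)
  have in_V: "p i \<in> V" if "i < card V" for i
    using p that by (auto simp: bij_betw_def)
  show thesis
  proof
    fix i j k assume *: "i < j" "j < k" "k < card V"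
    then have "R (p i) (p j)" "R (p j) (p k)"
      using R by auto
    then show "orient (p i) (p j) (p k) > 0"
      using orient_pos_if_sorted[of V v0 "p i" "p j" "p k"] assms(2,3) o in_V * unfolding R_def
      by auto
  qed (rule p)
qed

section \<open>Colorings from families of edge classes\<close>

text \<open>A new lowest color can be put under a coloring of a part of the edges, provided that
  every edge of that part crosses one of the remaining edges, which receive the new color.\<close>
lemma peel_coloring:
  assumes col: "pseudo_Grundy_coloring R k col" and R: "R \<subset> S"
    and cross: "\<And>e. e \<in> R \<Longrightarrow> \<exists>f\<in>S - R. crosses e f"
  shows "\<exists>col'. pseudo_Grundy_coloring S (Suc k) col'"
proof -
  define col' where "col' e = (if e \<in> R then Suc (col e) else 1)" for e
  have img: "col ` R = {1..k}"
    using col by (simp add: pseudo_Grundy_coloring_def)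
  have "col' ` S = col' ` R \<union> col' ` (S - R)"
    using R by blast
  also have "col' ` R = Suc ` col ` R"
    unfolding image_image by (rule image_cong) (simp_all add: col'_def)
  also have "Suc ` col ` R = {2..Suc k}"
    unfolding img image_Suc_atLeastAtMost by simp
  also have "col' ` (S - R) = {1}"
    using R by (auto simp: col'_def)
  finally have "col' ` S = {1..Suc k}"
    by auto
  moreover have "\<exists>f\<in>S. col' f = i \<and> crosses e f"
    if "i \<in> {1..Suc k}" "i < j" "e \<in> S" "col' e = j" for i j e
  proof -
    have e: "e \<in> R" "j = Suc (col e)"
      using that by (auto simp: col'_def split: if_splits)
    show ?thesis
    proof (cases "i = 1")
      case True
      then show ?thesis
        using cross[OF e(1)] by (auto simp: col'_def)
    next
      case False
      then have "i - 1 \<in> {1..k}" "i - 1 < col e" "col e \<in> {1..k}"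
        using that e img by auto
      then obtain f where "f \<in> R" "col f = i - 1" "crosses e f"
        using col e(1) unfolding pseudo_Grundy_coloring_def by blast
      then show ?thesis
        using that R by (intro bexI[of _ f]) (auto simp: col'_def)
    qed
  qed
  ultimately show ?thesis
    unfolding pseudo_Grundy_coloring_def by blast
qed

text \<open>The weight sorts the classes into color classes. The induction adds a class of least weight to
  the others, as the new lowest color.\<close>
lemma coloring_of_blocking_family:
  fixes w :: "'i \<Rightarrow> nat"
  assumes "finite I"
    and "\<And>i. i \<in> I \<Longrightarrow> F i \<noteq> {}"
    and "\<And>i j. i \<in> I \<Longrightarrow> j \<in> I \<Longrightarrow> i \<noteq> j \<Longrightarrow> F i \<inter> F j = {}"
    and "\<And>i j e. i \<in> I \<Longrightarrow> j \<in> I \<Longrightarrow> i \<noteq> j \<Longrightarrow> w i \<le> w j \<Longrightarrow> e \<in> F j \<Longrightarrow> \<exists>f\<in>F i. crosses e f"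
  shows "\<exists>col. pseudo_Grundy_coloring (\<Union>i\<in>I. F i) (card I) col"
  using assms
proof (induction I rule: finite_ranking_induct[where f = "\<lambda>i. - int (w i)"])
  case empty
  then show ?case
    by (simp add: pseudo_Grundy_coloring_def)
next
  case (insert x S)
  show ?case
  proof (cases "x \<in> S")
    case True
    then show ?thesis
      using insert.IH insert.prems by (simp add: insert_absorb)
  next
    case False
    have "\<exists>col. pseudo_Grundy_coloring (\<Union>i\<in>S. F i) (card S) col"
    proof (rule insert.IH)
      show "\<exists>f\<in>F i. crosses e f" if "i \<in> S" "j \<in> S" "i \<noteq> j" "w i \<le> w j" "e \<in> F j" for i j e
        using insert.prems(3)[of i j e] that by blast
      show "F i \<noteq> {}" if "i \<in> S" for i
        using insert.prems(1)[of i] that by blast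
      show "F i \<inter> F j = {}" if "i \<in> S" "j \<in> S" "i \<noteq> j" for i j
        using insert.prems(2)[of i j] that by blast
    qed
    moreover
    have disj: "F x \<inter> (\<Union>i\<in>S. F i) = {}"
    proof -
      have "F x \<inter> F i = {}" if "i \<in> S" for i
        using insert.prems(2)[of x i] False that by blast
      then show ?thesis by blast
    qed
    have "F x \<noteq> {}"
      using insert.prems(1)[of x] by blast
    then have "(\<Union>i\<in>S. F i) \<subset> (\<Union>i\<in>insert x S. F i)"
      using disj by blast
    moreover have "\<exists>f\<in>(\<Union>i\<in>insert x S. F i) - (\<Union>i\<in>S. F i). crosses e f"
      if "e \<in> (\<Union>i\<in>S. F i)" for e
    proof -
      obtain j where j: "j \<in> S" "e \<in> F j"
        using \<open>e \<in> (\<Union>i\<in>S. F i)\<close> by blast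
      then have "x \<noteq> j" "w x \<le> w j"
        using insert.hyps(2)[of j] False by auto
      then have "\<exists>f\<in>F x. crosses e f"
        using insert.prems(3)[of x j e] j by blast
      then show ?thesis
        using disj by blast
    qed
    ultimately show ?thesis
      using peel_coloring[of "\<Union>i\<in>S. F i" "card S" _ "\<Union>i\<in>insert x S. F i"]
        card_insert_disjoint[OF insert.hyps(1) False] by auto
  qed
qed

text \<open>Color 1 never has to be adjacent to a lower color, so it can absorb any further edges.\<close>
lemma extend_coloring:
  assumes col: "pseudo_Grundy_coloring R k col" and R: "R \<subseteq> S" "R \<noteq> {}"
  shows "\<exists>col'. pseudo_Grundy_coloring S k col'"
proof -
  define col' where "col' e = (if e \<in> R then col e else 1)" for e
  have img: "col ` R = {1..k}"
    using col by (simp add: pseudo_Grundy_coloring_def)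
  obtain e where "e \<in> R"
    using R by blast
  then have "col e \<in> {1..k}"
    unfolding img[symmetric] by (rule imageI)
  then have one: "1 \<in> {1..k}"
    by simp
  have "col' ` S = col' ` R \<union> col' ` (S - R)"
    using R by blast
  also have "col' ` R = {1..k}"
    unfolding img[symmetric] by (rule image_cong) (simp_all add: col'_def)
  also have "{1..k} \<union> col' ` (S - R) = {1..k}"
    using one by (auto simp: col'_def)
  finally have "col' ` S = {1..k}" .
  moreover have "\<exists>f\<in>S. col' f = i \<and> crosses e f"
    if "i \<in> {1..k}" "j \<in> {1..k}" "i < j" "e \<in> S" "col' e = j" for i j e
  proof -
    have e: "e \<in> R" "col e = j"
      using that by (auto simp: col'_def split: if_splits)
    have "\<forall>e\<in>R. col e = j \<longrightarrow> (\<exists>f\<in>R. col f = i \<and> crosses e f)"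
      using col that(1-3) unfolding pseudo_Grundy_coloring_def by meson
    then obtain f where "f \<in> R" "col f = i" "crosses e f"
      using e by metis
    then show ?thesis
      using R by (intro bexI[of _ f]) (auto simp: col'_def)
  qed
  ultimately show ?thesis
    unfolding pseudo_Grundy_coloring_def by blast
qed

lemma card_blocking_family_le_index:
  fixes w :: "'i \<Rightarrow> nat"
  assumes "finite E" "finite I"
    and ne: "\<And>i. i \<in> I \<Longrightarrow> F i \<noteq> {}"
    and sub: "\<And>i. i \<in> I \<Longrightarrow> F i \<subseteq> E"
    and "\<And>i j. i \<in> I \<Longrightarrow> j \<in> I \<Longrightarrow> i \<noteq> j \<Longrightarrow> F i \<inter> F j = {}"
    and "\<And>i j e. i \<in> I \<Longrightarrow> j \<in> I \<Longrightarrow> i \<noteq> j \<Longrightarrow> w i \<le> w j \<Longrightarrow> e \<in> F j \<Longrightarrow> \<exists>f\<in>F i. crosses e f"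
  shows "card I \<le> pseudo_Grundy_index E"
proof (cases "I = {}")
  case False
  have "\<exists>col. pseudo_Grundy_coloring (\<Union>i\<in>I. F i) (card I) col"
    by (rule coloring_of_blocking_family[where w = w]) (fact assms)+
  then obtain col where "pseudo_Grundy_coloring (\<Union>i\<in>I. F i) (card I) col" ..
  moreover have "(\<Union>i\<in>I. F i) \<subseteq> E"
    using sub by (rule UN_least)
  moreover obtain i where "i \<in> I"
    using False by blast
  then have "(\<Union>i\<in>I. F i) \<noteq> {}"
    using ne[of i] by blast
  ultimately obtain col' where "pseudo_Grundy_coloring E (card I) col'"
    using extend_coloring[of "\<Union>i\<in>I. F i"] by blast
  with assms(1) show ?thesis
    by (rule pseudo_Grundy_index_ge)
qed simp

section \<open>Chords of a convex polygon\<close>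

text \<open>The vertices are indexed by all integers with period \<open>n\<close>, so that rotations of the polygon
  are translations of the indices.\<close>
locale convex_polygon =
  fixes n :: int and P :: "int \<Rightarrow> point"
  assumes n_pos: "n > 0"
    and P_eq_iff: "P i = P j \<longleftrightarrow> n dvd i - j"
    and orient_pos: "i < j \<Longrightarrow> j < k \<Longrightarrow> k < i + n \<Longrightarrow> orient (P i) (P j) (P k) > 0"
begin

definition chord :: "int \<Rightarrow> int \<Rightarrow> point set" where
  "chord a l = {P a, P (a + l)}"

text \<open>The four vertices appear in the cyclic order \<open>a\<close>, \<open>c\<close>, \<open>b\<close>, \<open>d\<close>, so the two chords are the
  diagonals of a convex quadrilateral.\<close>
lemma interleaved_cross:
  assumes "a < c" "c < b" "b < d" "d < a + n"
  shows "crosses {P a, P b} {P c, P d}" "crosses {P c, P d} {P a, P b}"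
proof -
  have "open_segment (P a) (P b) \<inter> open_segment (P c) (P d) \<noteq> {}"
    using assms by (intro open_segments_meet orient_pos) auto
  moreover have "P a \<noteq> P c" "P a \<noteq> P d"
    using assms by (auto simp: P_eq_iff dest!: zdvd_imp_le[of n "c - a"] zdvd_imp_le[of n "d - a"]
        simp: dvd_diff_commute[of n a])
  then have "{P a, P b} \<noteq> {P c, P d}"
    by blast
  ultimately show "crosses {P a, P b} {P c, P d}" "crosses {P c, P d} {P a, P b}"
    unfolding crosses_def by blast+
qed

text \<open>Seen from a base vertex \<open>a\<close>, a chord that has at least \<open>l\<close> sides of the polygon on either side
  joins two offsets in \<open>{0..<n}\<close> that differ by at least \<open>l\<close> and at most \<open>n - l\<close>. This turns the
  crossing arguments below into linear arithmetic.\<close>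
lemma chord_relative:
  assumes "0 < l" "l \<le> k" "2 * k \<le> n"
  obtains s t where "chord b k = {P (a + s), P (a + t)}"
    "0 \<le> s" "s + l \<le> t" "t \<le> s + n - l" "t < n"
proof -
  define r where "r = (b - a) mod n"
  have r: "0 \<le> r" "r < n"
    using n_pos by (simp_all add: r_def)
  have dvd: "n dvd b - (a + r)"
    using dvd_minus_mod[of n "b - a"] by (simp add: r_def algebra_simps)
  then have "n dvd b + k - (a + (r + k))" "n dvd b + k - (a + (r + k - n))"
    using dvd_add[OF dvd dvd_refl] by (simp_all add: algebra_simps)
  then have b: "P b = P (a + r)" "P (b + k) = P (a + (r + k))" "P (b + k) = P (a + (r + k - n))"
    using dvd by (simp_all only: P_eq_iff)
  show thesis
  proof (cases "r + k < n")
    case True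
    then show ?thesis
      using that[of r "r + k"] b assms r by (simp add: chord_def)
  next
    case False
    then show ?thesis
      using that[of "r + k - n" r] b assms r by (simp add: chord_def insert_commute)
  qed
qed

lemma crosses_chord:
  assumes "u < s \<and> s < u + l \<and> u + l < t \<and> t < u + n \<or> s < u \<and> u < t \<and> t < u + l \<and> u + l < s + n"
  shows "crosses {P (a + s), P (a + t)} (chord (a + u) l)"
  using assms interleaved_cross[of "a + u" "a + s" "a + u + l" "a + t"]
    interleaved_cross[of "a + s" "a + u" "a + t" "a + u + l"]
  unfolding chord_def by auto

text \<open>The bound on the lengths makes a chord determine its length. It also determines its start, except
  that a diameter can be read from either end.\<close>
lemma chord_eqD:
  assumes eq: "chord a l = chord b k" and l: "0 < l" "2 * l \<le> n" and k: "0 < k" "2 * k \<le> n"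
  shows "l = k \<and> (n dvd a - b \<or> 2 * l = n \<and> n dvd a - b - l)"
proof -
  consider "P a = P b" "P (a + l) = P (b + k)" | "P a = P (b + k)" "P (a + l) = P b"
    using eq by (auto simp: chord_def doubleton_eq_iff)
  then show ?thesis
  proof cases
    case 1
    then have d: "n dvd a - b" "n dvd a + l - (b + k)"
      by (simp_all add: P_eq_iff)
    then have "n dvd l - k"
      using dvd_diff[OF d(2,1)] by simp
    then have "l = k"
      using l k by (auto simp: zdvd_not_zless dest: dvd_imp_le_int[rotated])
    then show ?thesis
      using d by simp
  next
    case 2
    then have d: "n dvd a - (b + k)" "n dvd a + l - b"
      by (simp_all add: P_eq_iff)
    then have "n dvd l + k"
      using dvd_diff[OF d(2,1)] by simp
    then have "n \<le> l + k"
      using l k by (intro zdvd_imp_le) auto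
    then have "l = k" "2 * l = n"
      using l k by auto
    then show ?thesis
      using d by (simp add: algebra_simps)
  qed
qed

section \<open>Classes that block all longer chords\<close>
definition diameter_class :: "int \<Rightarrow> int \<Rightarrow> point set set" where
  "diameter_class l i = {chord i l}"

text \<open>Two crossing chords of length \<open>l\<close> whose four ends cut the polygon into arcs of lengths
  \<open>n + 1 - 2 * l\<close>, \<open>3 * l - n - 1\<close>, \<open>n + 1 - 2 * l\<close> and \<open>l - 1\<close>. The last arc is as long as
  it may be, which lets \<open>l\<close> be as small as possible. For even \<open>n\<close> the offset
  \<open>n + 1 - 2 * l\<close> is odd, so the pairs match the even starts with the odd ones.\<close>
definition pair_class :: "int \<Rightarrow> int \<Rightarrow> point set set" where
  "pair_class l i = {chord (2 * i) l, chord (2 * i + (n + 1 - 2 * l)) l}"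

text \<open>A path of three steps of length \<open>l\<close>. For \<open>3 * l = n\<close> it closes up to a triangle, and for
  \<open>3 * l = n + 1\<close> it overshoots its start by one vertex.\<close>
definition triple_class :: "int \<Rightarrow> int \<Rightarrow> point set set" where
  "triple_class l i = {chord i l, chord (i + l) l, chord (i + 2 * l) l}"

text \<open>Any two diameters cross.\<close>
lemma diameter_class_blocks:
  assumes "2 * l = n" "l \<le> k" "2 * k \<le> n" and new: "chord b k \<notin> diameter_class l i"
  shows "\<exists>f\<in>diameter_class l i. crosses (chord b k) f"
proof -
  have l: "0 < l"
    using assms n_pos by linarith
  obtain s t where e: "chord b k = {P (i + s), P (i + t)}"
    and st: "0 \<le> s" "s + l \<le> t" "t \<le> s + n - l" "t < n"
    using l assms(2,3) by (rule chord_relative)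
  have "s \<noteq> 0"
  proof
    assume "s = 0"
    moreover from this have "t = l"
      using st assms(1) by linarith
    ultimately show False
      using new unfolding e by (simp add: diameter_class_def chord_def)
  qed
  then have "crosses (chord b k) (chord (i + 0) l)"
    unfolding e by (intro crosses_chord disjI1 conjI; use st l assms(1) in linarith)
  then show ?thesis
    by (simp add: diameter_class_def)
qed

text \<open>A chord that crosses neither of two crossing chords has both ends on one of the four arcs between
  consecutive endpoints, or is one of the two chords. Here every arc is shorter than \<open>l\<close>, and the two chords
  of the class cross each other, so they need no exception.\<close>
lemma pair_class_blocks:
  assumes "n + 2 \<le> 3 * l" "2 * l < n" "l \<le> k" "2 * k \<le> n"
  shows "\<exists>f\<in>pair_class l i. crosses (chord b k) f"
proof -
  have l: "0 < l"
    using assms n_pos by linarith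
  obtain s t where e: "chord b k = {P (2 * i + s), P (2 * i + t)}"
    and st: "0 \<le> s" "s + l \<le> t" "t \<le> s + n - l" "t < n"
    using l assms(3,4) by (rule chord_relative)
  consider "0 < s" "s < l" | "s = 0" | "l \<le> s"
    using st by linarith
  then show ?thesis
  proof cases
    case 1
    then have "crosses (chord b k) (chord (2 * i + 0) l)"
      unfolding e by (intro crosses_chord disjI1 conjI; use st in linarith)
    then show ?thesis
      by (simp add: pair_class_def)
  next
    case 2
    then have "crosses (chord b k) (chord (2 * i + (n + 1 - 2 * l)) l)"
      unfolding e by (intro crosses_chord disjI2 conjI; use st assms in linarith)
    then show ?thesis
      by (simp add: pair_class_def)
  next
    case 3
    then have "crosses (chord b k) (chord (2 * i + (n + 1 - 2 * l)) l)"
      unfolding e by (intro crosses_chord disjI1 conjI; use st assms in linarith)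
    then show ?thesis
      by (simp add: pair_class_def)
  qed
qed

text \<open>A chord that crosses no step of the path and does not start or end at one of its vertices
  has both ends between two consecutive vertices, hence is shorter than \<open>l\<close>. The
  cases \<open>s = l\<close> and \<open>s = 0\<close> are the chords that start at a vertex of the path.\<close>
lemma triple_class_blocks:
  assumes "n \<le> 3 * l" "3 * l \<le> n + 1" "2 \<le> l" "l \<le> k" "2 * k \<le> n"
    and new: "chord b k \<notin> triple_class l i"
  shows "\<exists>f\<in>triple_class l i. crosses (chord b k) f"
proof -
  have l: "0 < l"
    using assms by linarith
  obtain s t where e: "chord b k = {P (i + s), P (i + t)}"
    and st: "0 \<le> s" "s + l \<le> t" "t \<le> s + n - l" "t < n"
    using l assms(4,5) by (rule chord_relative)
  have third: "chord (i + 2 * l) l = {P (i + 2 * l), P i}" if "3 * l = n"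
  proof -
    have "P (i + 2 * l + l) = P i"
      using that by (simp add: P_eq_iff)
    then show ?thesis
      by (simp add: chord_def)
  qed
  have new': "{P (i + s), P (i + t)} \<noteq> chord i l" "{P (i + s), P (i + t)} \<noteq> chord (i + l) l"
    "{P (i + s), P (i + t)} \<noteq> chord (i + 2 * l) l"
    using new unfolding e triple_class_def by simp_all
  consider "0 < s" "s < l" | "l < s" | "s = l" | "s = 0"
    using st by linarith
  then show ?thesis
  proof cases
    case 1
    then have "crosses (chord b k) (chord (i + 0) l)"
      unfolding e by (intro crosses_chord disjI1 conjI; use st in linarith)
    then show ?thesis by (simp add: triple_class_def)
  next
    case 2
    then have "crosses (chord b k) (chord (i + l) l)"
      unfolding e by (intro crosses_chord disjI1 conjI; use st assms in linarith)
    then show ?thesis by (simp add: triple_class_def)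
  next
    case 3
    have "t \<noteq> 2 * l"
      using new'(2) 3 by (auto simp: chord_def algebra_simps)
    then have "2 * l < t"
      using 3 st by linarith
    with 3 have "crosses (chord b k) (chord (i + 2 * l) l)"
      unfolding e by (intro crosses_chord disjI2 conjI; use st assms in linarith)
    then show ?thesis by (simp add: triple_class_def)
  next
    case 4
    have "t \<noteq> l"
      using new'(1) 4 by (auto simp: chord_def)
    moreover have "t \<noteq> 2 * l" if "3 * l = n"
      using new'(3) third[OF that] 4 by (auto simp: insert_commute)
    ultimately have "l < t" "t < 2 * l"
      using 4 st assms(1,2) by linarith+
    with 4 have "crosses (chord b k) (chord (i + l) l)"
      unfolding e by (intro crosses_chord disjI2 conjI; use st assms in linarith)
    then show ?thesis by (simp add: triple_class_def)
  qed
qed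

lemma chord_in_edges:
  assumes "\<And>i j. P i \<noteq> P j \<Longrightarrow> {P i, P j} \<in> E" "0 < l" "l < n"
  shows "chord a l \<in> E"
proof -
  have "\<not> n dvd l"
    using assms by (simp add: zdvd_not_zless)
  then have "P a \<noteq> P (a + l)"
    by (simp add: P_eq_iff)
  then show ?thesis
    unfolding chord_def by (rule assms(1))
qed

lemma chord_eq_iff_start:
  assumes "0 < l" "2 * l < n"
  shows "chord a l = chord b l \<longleftrightarrow> n dvd a - b"
proof
  assume "n dvd a - b"
  then have "P a = P b" "P (a + l) = P (b + l)"
    by (simp_all add: P_eq_iff)
  then show "chord a l = chord b l"
    by (simp add: chord_def)
next
  assume "chord a l = chord b l"
  from chord_eqD[OF this] show "n dvd a - b"
    using assms by auto
qed

lemma diameter_class_disjoint: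
  assumes "2 * l = n" "0 \<le> i" "i < l" "0 \<le> j" "j < l" "i \<noteq> j"
  shows "diameter_class l i \<inter> diameter_class l j = {}"
proof -
  have False if "chord i l = chord j l"
  proof -
    have "n dvd i - j \<or> n dvd i - j - l"
      using chord_eqD[OF that] assms by auto
    then show False
    proof
      assume "n dvd i - j"
      from dvd_imp_le_int[OF _ this] show False
        using assms by auto
    next
      assume "n dvd i - j - l"
      from dvd_imp_le_int[OF _ this] show False
        using assms by auto
    qed
  qed
  then show ?thesis
    by (auto simp: diameter_class_def)
qed

text \<open>For even \<open>n\<close> the parity of a start is well defined, and it separates the first chords of
  the pairs from the second ones.\<close>
lemma pair_class_disjoint:
  assumes "n = 2 * h" "0 < l" "2 * l < n" "0 \<le> i" "i < h" "0 \<le> j" "j < h" "i \<noteq> j"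
  shows "pair_class l i \<inter> pair_class l j = {}"
proof -
  have ij: "\<not> n dvd 2 * i - 2 * j"
  proof
    assume "n dvd 2 * i - 2 * j"
    from dvd_imp_le_int[OF _ this] show False
      using assms by auto
  qed
  have odd: "\<not> n dvd a" if "odd a" for a
    using that assms(1) by (meson dvd_trans dvd_triv_left)
  show ?thesis
    unfolding pair_class_def using ij odd assms(1)
    by (auto simp: chord_eq_iff_start[OF assms(2,3)] algebra_simps)
qed

text \<open>The starts \<open>i\<close>, \<open>i + l\<close>, \<open>i + 2 * l\<close> lie in three consecutive blocks of \<open>l\<close> integers and
  below \<open>n\<close>, so two starts that agree modulo \<open>n\<close> come from the same path.\<close>
lemma triple_class_disjoint:
  assumes "0 < l" "2 * l < n" "0 \<le> i" "i < l" "i + 2 * l < n" "0 \<le> j" "j < l" "j + 2 * l < n" "i \<noteq> j"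
  shows "triple_class l i \<inter> triple_class l j = {}"
proof -
  have *: "\<not> n dvd (i + a) - (j + b)"
    if "a \<in> {0, l, 2 * l}" "b \<in> {0, l, 2 * l}" for a b
  proof
    assume "n dvd (i + a) - (j + b)"
    from dvd_imp_le_int[OF _ this] show False
      using assms that by auto
  qed
  have "chord (i + a) l \<noteq> chord (j + b) l" if "a \<in> {0, l, 2 * l}" "b \<in> {0, l, 2 * l}" for a b
    using *[OF that] by (simp add: chord_eq_iff_start[OF assms(1,2)])
  moreover have image: "triple_class l c = (\<lambda>a. chord (c + a) l) ` {0, l, 2 * l}" for c
    by (simp add: triple_class_def)
  ultimately show ?thesis
    unfolding image by blast
qed

section \<open>Counting the classes\<close>

text \<open>There are \<open>h\<close> classes for each length from \<open>m\<close> to \<open>h\<close>: pairs for the lengths below \<open>h\<close>, single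
  diameters for \<open>h\<close>. The \<open>t\<close> triples use the chords of length \<open>m - 1\<close>, where pairs no longer
  suffice. The length serves as the weight of a class.\<close>
lemma pseudo_Grundy_index_ge_classes:
  fixes h m t :: nat
  assumes E: "finite E" "\<And>i j. P i \<noteq> P j \<Longrightarrow> {P i, P j} \<in> E"
    and h: "n = 2 * int h" and m: "2 * h + 2 \<le> 3 * m"
    and t: "t = 0 \<or> 3 \<le> m \<and> 3 * m \<in> {2 * h + 3, 2 * h + 4} \<and> t < m \<and> t + 2 * m \<le> 2 * h + 2"
  shows "t + (h + 1 - m) * h \<le> pseudo_Grundy_index E"
proof -
  define I where "I = {m - 1} \<times> {..<t} \<union> {m..h} \<times> {..<h}"
  define cls where "cls = (\<lambda>(l, i). if l < m then triple_class (int l) (int i)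
    else if l < h then pair_class (int l) (int i) else diameter_class (int l) (int i))"
  have m_pos: "0 < m"
    using m by simp
  have I_cases: "l = m - 1 \<and> i < t \<and> 2 \<le> l \<and> 2 * l < 2 * h \<or> m \<le> l \<and> l < h \<and> i < h \<or> m \<le> l \<and> l = h \<and> i < h"
    if "(l, i) \<in> I" for l i
    using that t by (auto simp: I_def)
  have len: "0 < int l" "2 * int l \<le> n" if "(l, i) \<in> I" for l i
    using I_cases[OF that] h m_pos by auto
  have cls_chord: "\<exists>b. e = chord b (int l)" if "e \<in> cls (l, i)" for l i e
    using that by (auto simp: cls_def triple_class_def pair_class_def diameter_class_def split: if_splits)
  have disj: "cls p \<inter> cls q = {}" if "p \<in> I" "q \<in> I" "p \<noteq> q" for p q
  proof -
    obtain l i k j where pq: "p = (l, i)" "q = (k, j)"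
      by (cases p, cases q)
    show ?thesis
    proof (cases "l = k")
      case False
      show ?thesis
      proof (rule ccontr)
        assume "cls p \<inter> cls q \<noteq> {}"
        then obtain a b where "chord a (int l) = chord b (int k)"
          using cls_chord unfolding pq by blast
        from chord_eqD[OF this] have "int l = int k"
          using len that pq by blast
        then show False
          using False by simp
      qed
    next
      case True
      then have ij: "i \<noteq> j" and q: "q = (l, j)" and il: "(l, i) \<in> I" "(l, j) \<in> I"
        using that pq by auto
      consider "l < m" | "m \<le> l" "l < h" | "m \<le> l" "l = h"
        using I_cases[OF il(1)] by linarith
      then show ?thesis
      proof cases
        case 1
        then have l: "l = m - 1" "i < t" "j < t" "2 \<le> l"
          using I_cases[OF il(1)] I_cases[OF il(2)] by linarith+
        then have "3 * l \<in> {2 * h, 2 * h + 1}" "t \<le> l" "t + 2 * l \<le> 2 * h"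
          using t by auto
        then have "triple_class (int l) (int i) \<inter> triple_class (int l) (int j) = {}"
          using l h ij by (intro triple_class_disjoint) auto
        then show ?thesis
          using 1 m_pos by (simp add: cls_def pq(1) q)
      next
        case 2
        then have "i < h" "j < h"
          using I_cases[OF il(1)] I_cases[OF il(2)] by linarith+
        then have "pair_class (int l) (int i) \<inter> pair_class (int l) (int j) = {}"
          using 2 h ij m_pos by (intro pair_class_disjoint[of "int h"]) auto
        then show ?thesis
          using 2 by (simp add: cls_def pq(1) q)
      next
        case 3
        then have "i < h" "j < h"
          using I_cases[OF il(1)] I_cases[OF il(2)] by linarith+
        then have "diameter_class (int l) (int i) \<inter> diameter_class (int l) (int j) = {}"
          using 3 h ij by (intro diameter_class_disjoint) auto
        then show ?thesis
          using 3 by (simp add: cls_def pq(1) q)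
      qed
    qed
  qed
  have "card I \<le> pseudo_Grundy_index E"
  proof (rule card_blocking_family_le_index[where F = cls and w = fst])
    show "finite I"
      by (simp add: I_def)
    show "cls p \<noteq> {}" for p
      by (cases p) (simp add: cls_def triple_class_def pair_class_def diameter_class_def)
    show "cls p \<subseteq> E" if "p \<in> I" for p
    proof
      fix e assume "e \<in> cls p"
      then obtain l i b where "p = (l, i)" "e = chord b (int l)"
        using cls_chord by (cases p) blast
      then show "e \<in> E"
        using chord_in_edges[OF E(2), of "int l" b] len[of l i] that by simp
    qed
    show "cls p \<inter> cls q = {}" if "p \<in> I" "q \<in> I" "p \<noteq> q" for p q
      using disj that .
    show "\<exists>f\<in>cls p. crosses e f"
      if pq: "p \<in> I" "q \<in> I" "p \<noteq> q" "fst p \<le> fst q" and e: "e \<in> cls q" for p q e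
    proof -
      obtain l i k j where p: "p = (l, i)" and q: "q = (k, j)"
        by (cases p, cases q)
      obtain b where b: "e = chord b (int k)"
        using cls_chord e q by blast
      have new: "chord b (int k) \<notin> cls (l, i)"
        using disj[OF pq(1-3)] e b p by blast
      have k: "int l \<le> int k" "2 * int k \<le> n"
        using len[of k j] pq p q by simp_all
      consider "l = m - 1" "i < t" "2 \<le> l" | "m \<le> l" "l < h" | "m \<le> l" "l = h"
        using I_cases[of l i] pq(1) p by blast
      then show ?thesis
      proof cases
        case 1
        then have cls: "cls (l, i) = triple_class (int l) (int i)"
          using m_pos by (simp add: cls_def)
        have "n \<le> 3 * int l" "3 * int l \<le> n + 1" "2 \<le> int l"
          using 1 t h by auto
        from triple_class_blocks[OF this k new[unfolded cls]] show ?thesis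
          unfolding p b cls .
      next
        case 2
        then have cls: "cls (l, i) = pair_class (int l) (int i)"
          by (simp add: cls_def)
        have "n + 2 \<le> 3 * int l" "2 * int l < n"
          using 2 h m by auto
        from pair_class_blocks[OF this k] show ?thesis
          unfolding p b cls .
      next
        case 3
        then have cls: "cls (l, i) = diameter_class (int l) (int i)"
          by (simp add: cls_def)
        have "2 * int l = n"
          using 3 h by simp
        from diameter_class_blocks[OF this k new[unfolded cls]] show ?thesis
          unfolding p b cls .
      qed
    qed
  qed (rule E(1))
  moreover have "card I = t + (h + 1 - m) * h"
    unfolding I_def using m_pos by (subst card_Un_disjoint) auto
  ultimately show ?thesis
    by simp
qed

end

text \<open>Orientation is invariant under cyclic shifts of its arguments, so it stays positive for index
  triples that wrap around.\<close>
lemma convex_polygon_of_enumeration: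
  assumes inj: "inj_on p {..<N}" and N: "0 < N"
    and pos: "\<And>i j k. i < j \<Longrightarrow> j < k \<Longrightarrow> k < N \<Longrightarrow> orient (p i) (p j) (p k) > 0"
  shows "convex_polygon (int N) (\<lambda>i. p (nat (i mod int N)))"
proof
  let ?n = "int N"
  show "0 < ?n"
    using N by simp
  have lt: "nat (i mod ?n) < N" for i
    using N by (simp add: nat_less_iff)
  show "p (nat (i mod ?n)) = p (nat (j mod ?n)) \<longleftrightarrow> ?n dvd i - j" for i j
  proof -
    have "p (nat (i mod ?n)) = p (nat (j mod ?n)) \<longleftrightarrow> nat (i mod ?n) = nat (j mod ?n)"
      using lt by (intro inj_on_eq_iff[OF inj]) simp_all
    also have "\<dots> \<longleftrightarrow> i mod ?n = j mod ?n"
      using N by (simp add: eq_nat_nat_iff)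
    finally show ?thesis
      by (simp add: mod_eq_dvd_iff)
  qed
  show "0 < orient (p (nat (i mod ?n))) (p (nat (j mod ?n))) (p (nat (k mod ?n)))"
    if "i < j" "j < k" "k < i + ?n" for i j k
  proof -
    (* Shift the triple by a multiple of the period so that it starts in {0..<N}; then at most its
       last one or two members wrap around, once. *)
    define a where "a = i mod ?n"
    define b where "b = a + (j - i)"
    define c where "c = a + (k - i)"
    have a: "0 \<le> a" "a < ?n"
      using N by (simp_all add: a_def)
    have abc: "a < b" "b < c" "c < a + ?n"
      using that by (simp_all add: b_def c_def)
    have mods: "j mod ?n = b mod ?n" "k mod ?n = c mod ?n"
      by (simp_all add: a_def b_def c_def mod_simps)
    have red: "x mod ?n = x - ?n" if "?n \<le> x" "x < 2 * ?n" for x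
      using that N mod_pos_geq[of ?n x] mod_pos_pos_trivial[of "x - ?n" ?n] by linarith
    consider "c < ?n" | "b < ?n" "?n \<le> c" | "?n \<le> b"
      by linarith
    then show ?thesis
    proof cases
      case 1
      then show ?thesis
        unfolding mods a_def[symmetric] using a abc by (intro pos) auto
    next
      case 2
      then have "orient (p (nat (c - ?n))) (p (nat a)) (p (nat b)) > 0"
        using a abc by (intro pos) auto
      then show ?thesis
        unfolding mods a_def[symmetric] using 2 a abc by (simp add: red orient_rotate)
    next
      case 3
      then have "orient (p (nat (b - ?n))) (p (nat (c - ?n))) (p (nat a)) > 0"
        using a abc by (intro pos) auto
      then show ?thesis
        unfolding mods a_def[symmetric] using 3 a abc by (simp add: red orient_rotate)
    qed
  qed
qed

text \<open>The classes live on the first \<open>2 * h\<close> vertices in the cyclic order. Edges at the other vertices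
  end up in color 1.\<close>
lemma pseudo_Grundy_index_ge_even_subpolygon:
  assumes G: "complete_convex_graph n V E" and h: "2 * h \<le> n" and m: "2 * h + 2 \<le> 3 * m"
    and t: "t = 0 \<or> 3 \<le> m \<and> 3 * m \<in> {2 * h + 3, 2 * h + 4} \<and> t < m \<and> t + 2 * m \<le> 2 * h + 2"
  shows "t + (h + 1 - m) * h \<le> pseudo_Grundy_index E"
proof (cases "h = 0")
  case True
  then show ?thesis
    using t by auto
next
  case False
  have V: "finite V" "general_position V" "convex_position V" "card V = n"
    and E: "E = {e. e \<subseteq> V \<and> card e = 2}"
    using G unfolding complete_convex_graph_def geometric_graph_def by blast+
  have "finite E"
    using G finite_edges unfolding complete_convex_graph_def by blast
  obtain p where p: "bij_betw p {..<n} V"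
    and pos: "\<And>i j k. i < j \<Longrightarrow> j < k \<Longrightarrow> k < n \<Longrightarrow> orient (p i) (p j) (p k) > 0"
    using cyclic_enumeration[OF V(1-3)] unfolding V(4) by blast
  define P where "P i = p (nat (i mod int (2 * h)))" for i
  interpret convex_polygon "int (2 * h)" P
    unfolding P_def
  proof (rule convex_polygon_of_enumeration)
    show "inj_on p {..<2 * h}"
      using bij_betw_imp_inj_on[OF p] by (rule inj_on_subset) (use h in auto)
    show "0 < orient (p i) (p j) (p k)" if "i < j" "j < k" "k < 2 * h" for i j k
      using that h by (intro pos) simp_all
  qed (use False in simp)
  have P_in: "P i \<in> V" for i
  proof -
    have "i mod int (2 * h) < int (2 * h)"
      using False by simp
    then have "nat (i mod int (2 * h)) < n"
      using h False by linarith
    then show ?thesis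
      unfolding P_def using bij_betw_apply[OF p] by simp
  qed
  have "{P i, P j} \<in> E" if "P i \<noteq> P j" for i j
    using that P_in by (simp add: E)
  from pseudo_Grundy_index_ge_classes[OF \<open>finite E\<close> this _ m t] show ?thesis
    by simp
qed

theorem theorem2:
  fixes n :: nat and V :: "point set" and E :: "point set set"
  assumes "complete_convex_graph n V E"
  shows "(real n ^ 2 - 16) / 12 \<le> real (pseudo_Grundy_index E)"
proof -
  define j where "j = n div 6"
  obtain h m t where h: "2 * h \<le> n" and m: "2 * h + 2 \<le> 3 * m"
    and t: "t = 0 \<or> 3 \<le> m \<and> 3 * m \<in> {2 * h + 3, 2 * h + 4} \<and> t < m \<and> t + 2 * m \<le> 2 * h + 2"
    and count: "n ^ 2 \<le> 12 * (t + (h + 1 - m) * h) + 16"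
  proof -
    have "n \<in> {6 * j, 6 * j + 1} \<or> n \<in> {6 * j + 2, 6 * j + 3} \<or> n \<in> {6 * j + 4, 6 * j + 5}"
      unfolding j_def by (simp, presburger)
    then consider "n \<in> {6 * j, 6 * j + 1}" | "n \<in> {6 * j + 2, 6 * j + 3}" | "n \<in> {6 * j + 4, 6 * j + 5}"
      by blast
    (* In each case 2 * h is the even one of the two values, and m is the least length with
       3 * m >= 2 * h + 2. In the last case 2 * h is 1 modulo 3, so m - 1 is too short for triples,
       and the pairs and diameters suffice. *)
    then show thesis
    proof cases
      case 1
      then show thesis
        by (intro that[of "3 * j" "2 * j + 1" "2 * j"]) (auto simp: power2_eq_square algebra_simps)
    next
      case 2
      then show thesis
        by (intro that[of "3 * j + 1" "2 * j + 2" "2 * j"]) (auto simp: power2_eq_square algebra_simps)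
    next
      case 3
      then show thesis
        by (intro that[of "3 * j + 2" "2 * j + 2" 0]) (auto simp: power2_eq_square algebra_simps)
    qed
  qed
  have "t + (h + 1 - m) * h \<le> pseudo_Grundy_index E"
    using assms h m t by (rule pseudo_Grundy_index_ge_even_subpolygon)
  then have "12 * (t + (h + 1 - m) * h) + 16 \<le> 12 * pseudo_Grundy_index E + 16"
    by (intro add_right_mono mult_left_mono) simp_all
  with count have "n ^ 2 \<le> 12 * pseudo_Grundy_index E + 16"
    by (rule le_trans)
  then have "real (n ^ 2) \<le> real (12 * pseudo_Grundy_index E + 16)"
    by (simp only: of_nat_le_iff)
  then show ?thesis
    by simp
qed

end
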